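(* Let $V$ be a representation over a field $k$ of the Artin braid group $Br_3=\langle s_1,s_2\mid s_1s_2s_1=s_2s_1s_2\rangle$, such that for both generators $s=s_1$ and $s=s_2$ the identity $$(s^2-1)(s-\lambda)=0$$ is satisfied in $V$, where $\lambda\in k$ is an element such that $\lambda^6\ne1$. Then $V$ is good.
   Context: Let $(W,S)$ be a finite Coxeter group with braid group $B$, and $\tau:W\to B$ the canonical section given by reduced decompositions ($\tau(s)=s$ for $s\in S$, $\tau(ww')=\tau(w)\tau(w')$ when $\ell(ww')=\ell(w)+\ell(w')$). For a representation $V$ of $B$ put $V_s=(s^2-1)V$ for $s\in S$, and $$K_W(V)=\{(x_w)_{w\in W}\in V^W:\ x_{sw}-s\,x_w\in V_s\ \text{for all } s\in S,\ w\in W\}$$ (in the index, $s$ denotes the element of $W$; in $s\,x_w$ it denotes the generator of $B$). For $y\in W$ there is an embedding $i_y:V\to K_W(V)$, $i_y(v)=(\tau(wy^{-1})v)_{w\in W}$. The representation $V$ is called good if $K_W(V)$ is generated (spanned) by the subspaces $i_y(V)$, $y\in W$. Here $B=Br_3$ and $W=S_3$ is the symmetric group with its two simple reflections. *)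

theory Defs
  imports
    "HOL-Algebra.Sym_Groups"
    "HOL-Algebra.Group_Action"
    "HOL-Algebra.Multiplicative_Group"
    "HOL-Library.Function_Algebras"
begin

section \<open>Groups given by generators and relations\<close>

text \<open>The letter \<open>(x, True)\<close> stands for the generator \<open>x\<close> and \<open>(x, False)\<close> for its inverse.
  A relation is a pair of words that become equal in the group.\<close>

type_synonym 'g word = "('g \<times> bool) list"

definition words :: "'g set \<Rightarrow> 'g word set" where
  "words X = lists (X \<times> UNIV)"

inductive_set word_rel :: "'g set \<Rightarrow> ('g word \<times> 'g word) set \<Rightarrow> ('g word \<times> 'g word) set"
  for X :: "'g set" and R :: "('g word \<times> 'g word) set" where
  refl: "u \<in> words X \<Longrightarrow> (u, u) \<in> word_rel X R"
| sym: "(u, v) \<in> word_rel X R \<Longrightarrow> (v, u) \<in> word_rel X R"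
| trans: "(u, v) \<in> word_rel X R \<Longrightarrow> (v, w) \<in> word_rel X R \<Longrightarrow> (u, w) \<in> word_rel X R"
| cancel: "u \<in> words X \<Longrightarrow> v \<in> words X \<Longrightarrow> x \<in> X \<Longrightarrow>
    (u @ [(x, b), (x, \<not> b)] @ v, u @ v) \<in> word_rel X R"
| relation: "u \<in> words X \<Longrightarrow> v \<in> words X \<Longrightarrow> l \<in> words X \<Longrightarrow> r \<in> words X \<Longrightarrow> (l, r) \<in> R \<Longrightarrow>
    (u @ l @ v, u @ r @ v) \<in> word_rel X R"

definition presented_group :: "'g set \<Rightarrow> ('g word \<times> 'g word) set \<Rightarrow> 'g word set monoid" where
  "presented_group X R =
    \<lparr>carrier = words X // word_rel X R,
     mult = (\<lambda>A B. \<Union>u\<in>A. \<Union>v\<in>B. word_rel X R `` {u @ v}),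
     one = word_rel X R `` {[]}\<rparr>"

lemma words_simps [simp]:
  "[] \<in> words X" "p # u \<in> words X \<longleftrightarrow> fst p \<in> X \<and> u \<in> words X"
  "u @ v \<in> words X \<longleftrightarrow> u \<in> words X \<and> v \<in> words X"
  by (cases p; auto simp: words_def)+

lemma word_rel_words: "(u, v) \<in> word_rel X R \<Longrightarrow> u \<in> words X \<and> v \<in> words X"
  by (induction rule: word_rel.induct) auto

lemma equiv_word_rel: "equiv (words X) (word_rel X R)"
  by (rule equivI)
    (auto simp: refl_on_def sym_def trans_def intro: word_rel.intros dest: word_rel_words)

lemma word_rel_context:
  assumes "(u, v) \<in> word_rel X R" "p \<in> words X" "q \<in> words X"
  shows "(p @ u @ q, p @ v @ q) \<in> word_rel X R"
  using assms
proof (induction rule: word_rel.induct)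
  case (cancel u v x b)
  then show ?case using word_rel.cancel[of "p @ u" X "v @ q" x b R] by simp
next
  case (relation u v l r)
  then show ?case using word_rel.relation[of "p @ u" X "v @ q" l r R] by simp
qed (auto intro: word_rel.refl word_rel.sym word_rel.trans)

lemma word_rel_append:
  assumes "(u, u') \<in> word_rel X R" "(v, v') \<in> word_rel X R"
  shows "(u @ v, u' @ v') \<in> word_rel X R"
proof -
  have "(u @ v, u' @ v) \<in> word_rel X R"
    using word_rel_context[OF assms(1), of "[]" v] word_rel_words[OF assms(2)] by simp
  moreover have "(u' @ v, u' @ v') \<in> word_rel X R"
    using word_rel_context[OF assms(2), of u' "[]"] word_rel_words[OF assms(1)] by simp
  ultimately show ?thesis by (rule word_rel.trans)
qed

lemma presented_group_mult:
  assumes "u \<in> words X" "v \<in> words X"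
  shows "word_rel X R `` {u} \<otimes>\<^bsub>presented_group X R\<^esub> word_rel X R `` {v} = word_rel X R `` {u @ v}"
proof -
  have "word_rel X R `` {u' @ v'} = word_rel X R `` {u @ v}"
    if "(u, u') \<in> word_rel X R" "(v, v') \<in> word_rel X R" for u' v'
    using equiv_class_eq[OF equiv_word_rel word_rel_append[OF that]] by simp
  then have "(\<Union>u'\<in>word_rel X R `` {u}. \<Union>v'\<in>word_rel X R `` {v}. word_rel X R `` {u' @ v'}) =
      (\<Union>u'\<in>word_rel X R `` {u}. \<Union>v'\<in>word_rel X R `` {v}. word_rel X R `` {u @ v})"
    by (intro SUP_cong HOL.refl) simp
  moreover have "word_rel X R `` {u} \<noteq> {}" "word_rel X R `` {v} \<noteq> {}"
    using assms by (blast intro: word_rel.refl)+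
  ultimately show ?thesis by (simp add: presented_group_def)
qed

lemma word_rel_inverse:
  "u \<in> words X \<Longrightarrow> (rev (map (apsnd Not) u) @ u, []) \<in> word_rel X R
    \<and> rev (map (apsnd Not) u) \<in> words X"
proof (induction u)
  case Nil
  then show ?case by (simp add: word_rel.refl)
next
  case (Cons p u)
  obtain x b where p: "p = (x, b)" by (cases p)
  let ?i = "rev (map (apsnd Not) u)"
  have "(?i @ [(x, \<not> b), (x, \<not> \<not> b)] @ u, ?i @ u) \<in> word_rel X R"
    using Cons p by (intro word_rel.cancel) auto
  then show ?case using Cons p by (auto intro: word_rel.trans)
qed

lemma group_presented_group: "group (presented_group X R)"
proof (rule groupI)
  let ?G = "presented_group X R"
  have c: "carrier ?G = (\<lambda>u. word_rel X R `` {u}) ` words X"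
    by (auto simp: presented_group_def quotient_def)
  have o: "\<one>\<^bsub>?G\<^esub> = word_rel X R `` {[]}"
    by (simp add: presented_group_def)
  note m = presented_group_mult
  show "x \<otimes>\<^bsub>?G\<^esub> y \<in> carrier ?G" if "x \<in> carrier ?G" "y \<in> carrier ?G" for x y
    using that by (auto simp: c m)
  show "\<one>\<^bsub>?G\<^esub> \<in> carrier ?G" by (auto simp: c o)
  show "x \<otimes>\<^bsub>?G\<^esub> y \<otimes>\<^bsub>?G\<^esub> z = x \<otimes>\<^bsub>?G\<^esub> (y \<otimes>\<^bsub>?G\<^esub> z)"
    if "x \<in> carrier ?G" "y \<in> carrier ?G" "z \<in> carrier ?G" for x y z
    using that by (auto simp: c m)
  show "\<one>\<^bsub>?G\<^esub> \<otimes>\<^bsub>?G\<^esub> x = x" if "x \<in> carrier ?G" for x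
    using that by (auto simp: c m o)
  show "\<exists>y\<in>carrier ?G. y \<otimes>\<^bsub>?G\<^esub> x = \<one>\<^bsub>?G\<^esub>" if x: "x \<in> carrier ?G" for x
  proof -
    obtain u where u: "u \<in> words X" "x = word_rel X R `` {u}"
      using x unfolding c by blast
    have "word_rel X R `` {rev (map (apsnd Not) u)} \<otimes>\<^bsub>?G\<^esub> x = \<one>\<^bsub>?G\<^esub>"
      using u word_rel_inverse[OF u(1), of R]
      by (simp add: m o equiv_class_eq[OF equiv_word_rel])
    then show ?thesis using word_rel_inverse[OF u(1), of R] by (auto simp: c)
  qed
qed


section \<open>Braid groups of Coxeter groups\<close>

text \<open>In this section \<open>(W, S)\<close> is a Coxeter group with its set of simple reflections.\<close>

fun alternating :: "'g \<Rightarrow> 'g \<Rightarrow> nat \<Rightarrow> 'g list" where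
  "alternating s t 0 = []"
| "alternating s t (Suc n) = s # alternating t s n"

definition pos_word :: "'g list \<Rightarrow> 'g word" where
  "pos_word us = map (\<lambda>s. (s, True)) us"

text \<open>If the order of \<open>s t\<close> is infinite, then \<open>group.ord\<close> is 0 and no relation is imposed.\<close>

definition braid_relations :: "('g, 'b) monoid_scheme \<Rightarrow> 'g set \<Rightarrow> ('g word \<times> 'g word) set" where
  "braid_relations W S =
    {(pos_word (alternating s t m), pos_word (alternating t s m)) | s t m.
       s \<in> S \<and> t \<in> S \<and> s \<noteq> t \<and> m = group.ord W (s \<otimes>\<^bsub>W\<^esub> t)}"

definition braid_group :: "('g, 'b) monoid_scheme \<Rightarrow> 'g set \<Rightarrow> 'g word set monoid" where
  "braid_group W S = presented_group S (braid_relations W S)"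

definition pos_braid :: "('g, 'b) monoid_scheme \<Rightarrow> 'g set \<Rightarrow> 'g list \<Rightarrow> 'g word set" where
  "pos_braid W S us = word_rel S (braid_relations W S) `` {pos_word us}"

definition braid_gen :: "('g, 'b) monoid_scheme \<Rightarrow> 'g set \<Rightarrow> 'g \<Rightarrow> 'g word set" where
  "braid_gen W S s = pos_braid W S [s]"

definition list_prod :: "('g, 'b) monoid_scheme \<Rightarrow> 'g list \<Rightarrow> 'g" where
  "list_prod W us = foldr (mult W) us \<one>\<^bsub>W\<^esub>"

definition reduced_decomposition ::
    "('g, 'b) monoid_scheme \<Rightarrow> 'g set \<Rightarrow> 'g \<Rightarrow> 'g list \<Rightarrow> bool" where
  "reduced_decomposition W S w us \<longleftrightarrow>
     us \<in> lists S \<and> list_prod W us = w \<and>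
     (\<forall>vs\<in>lists S. list_prod W vs = w \<longrightarrow> length us \<le> length vs)"

definition braid_section :: "('g, 'b) monoid_scheme \<Rightarrow> 'g set \<Rightarrow> 'g \<Rightarrow> 'g word set" where
  "braid_section W S w = pos_braid W S (SOME us. reduced_decomposition W S w us)"


section \<open>Representations and goodness\<close>

definition representation ::
    "('g, 'b) monoid_scheme \<Rightarrow> ('k::field \<Rightarrow> 'v::ab_group_add \<Rightarrow> 'v) \<Rightarrow> ('g \<Rightarrow> 'v \<Rightarrow> 'v) \<Rightarrow> bool" where
  "representation G scale \<rho> \<longleftrightarrow>
     vector_space scale \<and> group_action G UNIV \<rho> \<and>
     (\<forall>g\<in>carrier G. Vector_Spaces.linear scale scale (\<rho> g))"

definition V_sub ::
    "('g, 'b) monoid_scheme \<Rightarrow> 'g set \<Rightarrow> ('g word set \<Rightarrow> 'v::ab_group_add \<Rightarrow> 'v) \<Rightarrow> 'g \<Rightarrow> 'v set" where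
  "V_sub W S \<rho> s =
     range ((\<rho> (braid_gen W S s) \<circ> \<rho> (braid_gen W S s)) - id)"

text \<open>A family in \<open>V\<^sup>W\<close> is encoded as a function that vanishes outside the carrier of \<open>W\<close>.\<close>

definition K_space ::
    "('g, 'b) monoid_scheme \<Rightarrow> 'g set \<Rightarrow> ('g word set \<Rightarrow> 'v::ab_group_add \<Rightarrow> 'v) \<Rightarrow> ('g \<Rightarrow> 'v) set" where
  "K_space W S \<rho> =
     {x. (\<forall>w. w \<notin> carrier W \<longrightarrow> x w = 0) \<and>
         (\<forall>s\<in>S. \<forall>w\<in>carrier W. x (s \<otimes>\<^bsub>W\<^esub> w) - \<rho> (braid_gen W S s) (x w) \<in> V_sub W S \<rho> s)}"

definition K_embed ::
    "('g, 'b) monoid_scheme \<Rightarrow> 'g set \<Rightarrow> ('g word set \<Rightarrow> 'v::ab_group_add \<Rightarrow> 'v) \<Rightarrow> 'g \<Rightarrow> 'v \<Rightarrow> 'g \<Rightarrow> 'v" where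
  "K_embed W S \<rho> y v =
     (\<lambda>w. if w \<in> carrier W then \<rho> (braid_section W S (w \<otimes>\<^bsub>W\<^esub> inv\<^bsub>W\<^esub> y)) v else 0)"

definition good ::
    "('g, 'b) monoid_scheme \<Rightarrow> 'g set \<Rightarrow> ('k::field \<Rightarrow> 'v::ab_group_add \<Rightarrow> 'v) \<Rightarrow>
     ('g word set \<Rightarrow> 'v \<Rightarrow> 'v) \<Rightarrow> bool" where
  "good W S scale \<rho> \<longleftrightarrow>
     module.span (\<lambda>c x w. scale c (x w)) (\<Union>y\<in>carrier W. range (K_embed W S \<rho> y)) = K_space W S \<rho>"


section \<open>The symmetric group on three letters\<close>

abbreviation S3 :: "(nat \<Rightarrow> nat) monoid" where
  "S3 \<equiv> sym_group 3"

definition s1 :: "nat \<Rightarrow> nat" where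
  "s1 = transpose 1 2"

definition s2 :: "nat \<Rightarrow> nat" where
  "s2 = transpose 2 3"

definition Br3 :: "(nat \<Rightarrow> nat) word set monoid" where
  "Br3 = presented_group {s1, s2} {(pos_word [s1, s2, s1], pos_word [s2, s1, s2])}"

lemma s1_ne_s2: "s1 \<noteq> s2"
proof
  assume "s1 = s2"
  then have "s1 1 = s2 1" by simp
  then show False by (simp add: s1_def s2_def transpose_def)
qed

lemma s1_s1: "s1 \<circ> s1 = id" and s2_s2: "s2 \<circ> s2 = id"
  by (simp_all add: s1_def s2_def)

lemma s_braid: "s1 \<circ> s2 \<circ> s1 = s2 \<circ> s1 \<circ> s2"
  by (auto simp: s1_def s2_def transpose_def fun_eq_iff)

lemma s1_carrier: "s1 \<in> carrier S3" and s2_carrier: "s2 \<in> carrier S3"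
  unfolding sym_group_carrier s1_def s2_def by (auto intro: permutes_swap_id)

lemma ord_3:
  assumes "a \<in> carrier S3" "a \<circ> a \<circ> a = id" "a \<noteq> id"
  shows "group.ord S3 a = 3"
proof -
  interpret group S3 by (rule sym_group_is_group)
  have "a [^]\<^bsub>S3\<^esub> (3::nat) = \<one>\<^bsub>S3\<^esub>"
    using assms by (simp add: numeral_3_eq_3 sym_group_mult sym_group_one)
  then have "ord a dvd 3" using pow_eq_id[OF assms(1)] by simp
  moreover have "ord a \<noteq> 1"
    using assms ord_eq_1[OF assms(1)] by (simp add: sym_group_one)
  moreover have "ord a = 1 \<or> ord a = 2 \<or> ord a = 3"
    using \<open>ord a dvd 3\<close> dvd_imp_le[of "ord a" 3] by (cases "ord a = 0") auto
  ultimately show ?thesis by auto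
qed

lemma ord_s1_s2: "group.ord S3 (s1 \<otimes>\<^bsub>S3\<^esub> s2) = 3" "group.ord S3 (s2 \<otimes>\<^bsub>S3\<^esub> s1) = 3"
proof -
  interpret group S3 by (rule sym_group_is_group)
  have c: "s1 \<circ> s2 \<in> carrier S3" "s2 \<circ> s1 \<in> carrier S3"
    using m_closed[OF s1_carrier s2_carrier] m_closed[OF s2_carrier s1_carrier]
    by (simp_all add: sym_group_mult)
  have n': "(s1 \<circ> s2) 1 \<noteq> id 1" "(s2 \<circ> s1) 1 \<noteq> id 1"
    by (simp_all add: s1_def s2_def transpose_def)
  then have n: "s1 \<circ> s2 \<noteq> id" "s2 \<circ> s1 \<noteq> id" by (metis, metis)
  have t: "s1 \<circ> s2 \<circ> (s1 \<circ> s2) \<circ> (s1 \<circ> s2) = id" "s2 \<circ> s1 \<circ> (s2 \<circ> s1) \<circ> (s2 \<circ> s1) = id"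
    by (auto simp: s1_def s2_def transpose_def fun_eq_iff)
  show "group.ord S3 (s1 \<otimes>\<^bsub>S3\<^esub> s2) = 3" "group.ord S3 (s2 \<otimes>\<^bsub>S3\<^esub> s1) = 3"
    unfolding sym_group_mult using ord_3[OF c(1) t(1) n(1)] ord_3[OF c(2) t(2) n(2)] by auto
qed

lemma alternating_3: "alternating s t 3 = [s, t, s]"
  by (simp add: numeral_3_eq_3)

lemma braid_relations_S3:
  "braid_relations S3 {s1, s2} =
    {(pos_word [s1, s2, s1], pos_word [s2, s1, s2]), (pos_word [s2, s1, s2], pos_word [s1, s2, s1])}"
  (is "_ = ?R")
proof
  show "braid_relations S3 {s1, s2} \<subseteq> ?R"
  proof
    fix p assume "p \<in> braid_relations S3 {s1, s2}"
    then obtain s t where p: "s \<in> {s1, s2}" "t \<in> {s1, s2}" "s \<noteq> t"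
      "p = (pos_word (alternating s t (group.ord S3 (s \<otimes>\<^bsub>S3\<^esub> t))),
            pos_word (alternating t s (group.ord S3 (s \<otimes>\<^bsub>S3\<^esub> t))))"
      unfolding braid_relations_def by blast
    then consider "s = s1" "t = s2" | "s = s2" "t = s1" by blast
    then show "p \<in> ?R"
      by cases (simp_all only: p ord_s1_s2 alternating_3 insert_iff simp_thms)
  qed
  have "(pos_word (alternating s t 3), pos_word (alternating t s 3)) \<in> braid_relations S3 {s1, s2}"
    if "s \<in> {s1, s2}" "t \<in> {s1, s2}" "s \<noteq> t" "group.ord S3 (s \<otimes>\<^bsub>S3\<^esub> t) = 3" for s t
    unfolding braid_relations_def using that by (intro CollectI exI[of _ s] exI[of _ t] exI[of _ 3]) simp
  from this[of s1 s2] this[of s2 s1] show "?R \<subseteq> braid_relations S3 {s1, s2}"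
    using s1_ne_s2 by (simp add: ord_s1_s2 alternating_3)
qed

lemma word_rel_mono_closed:
  assumes "(u, v) \<in> word_rel X R"
    and "\<And>l r. (l, r) \<in> R \<Longrightarrow> l \<in> words X \<Longrightarrow> r \<in> words X \<Longrightarrow> (l, r) \<in> word_rel X R'"
  shows "(u, v) \<in> word_rel X R'"
  using assms(1)
proof (induction rule: word_rel.induct)
  case (relation u v l r)
  then show ?case using word_rel_context assms(2) by blast
next
  case (sym u v)
  then show ?case by (blast intro: word_rel.sym)
next
  case (trans u v w)
  then show ?case by (blast intro: word_rel.trans)
qed (rule word_rel.intros; assumption)+

lemma word_rel_S3:
  "word_rel {s1, s2} (braid_relations S3 {s1, s2}) =
   word_rel {s1, s2} {(pos_word [s1, s2, s1], pos_word [s2, s1, s2])}"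
proof -
  let ?l = "pos_word [s1, s2, s1]" and ?r = "pos_word [s2, s1, s2]"
  let ?R = "braid_relations S3 {s1, s2}" and ?R' = "{(?l, ?r)}"
  have w: "?l \<in> words {s1, s2}" "?r \<in> words {s1, s2}" by (simp_all add: pos_word_def)
  have 1: "(?l, ?r) \<in> word_rel {s1, s2} R" if "(?l, ?r) \<in> R" for R
    using word_rel.relation[of "[]" "{s1, s2}" "[]" ?l ?r R] that w by simp
  have "(u, v) \<in> word_rel {s1, s2} ?R'" if "(u, v) \<in> word_rel {s1, s2} ?R" for u v
    using that by (rule word_rel_mono_closed) (use 1[of ?R'] in \<open>auto simp: braid_relations_S3 word_rel.sym\<close>)
  moreover have "(u, v) \<in> word_rel {s1, s2} ?R" if "(u, v) \<in> word_rel {s1, s2} ?R'" for u v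
    using that by (rule word_rel_mono_closed) (use 1[of ?R] in \<open>auto simp: braid_relations_S3\<close>)
  ultimately show ?thesis by auto
qed

lemma braid_group_S3: "braid_group S3 {s1, s2} = Br3"
  by (simp add: braid_group_def Br3_def presented_group_def word_rel_S3)

lemma pos_braid_S3: "pos_braid S3 {s1, s2} [s1, s2, s1] = pos_braid S3 {s1, s2} [s2, s1, s2]"
proof -
  have "([] @ pos_word [s1, s2, s1] @ [], [] @ pos_word [s2, s1, s2] @ [])
      \<in> word_rel {s1, s2} (braid_relations S3 {s1, s2})"
    by (intro word_rel.relation) (auto simp: pos_word_def braid_relations_S3)
  then show ?thesis by (simp add: pos_braid_def equiv_class_eq[OF equiv_word_rel])
qed

lemma list_prod_S3: "list_prod S3 us = foldr (\<circ>) us id"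
  by (simp add: list_prod_def sym_group_mult sym_group_one)

lemma list_prod_S3_append: "list_prod S3 (us @ vs) = list_prod S3 us \<circ> list_prod S3 vs"
  by (induction us) (auto simp: list_prod_S3)

lemma s_rels:
  "s1 \<circ> (s2 \<circ> (s1 \<circ> s2)) = s2 \<circ> s1" "s2 \<circ> (s1 \<circ> (s2 \<circ> s1)) = s1 \<circ> s2"
  by (auto simp: s1_def s2_def transpose_def fun_eq_iff)

lemma reduced_shape_S3:
  assumes "reduced_decomposition S3 {s1, s2} w us"
  shows "us \<in> {[], [s1], [s2], [s1, s2], [s2, s1], [s1, s2, s1], [s2, s1, s2]}"
proof -
  have shorter: "\<not> (us = p @ q @ r \<and> q' \<in> lists {s1, s2} \<and> length q' < length q \<and>
      list_prod S3 q' = list_prod S3 q)" for p q r q'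
  proof
    assume a: "us = p @ q @ r \<and> q' \<in> lists {s1, s2} \<and> length q' < length q \<and>
      list_prod S3 q' = list_prod S3 q"
    then have "list_prod S3 (p @ q' @ r) = w" "p @ q' @ r \<in> lists {s1, s2}"
      using assms by (auto simp: reduced_decomposition_def list_prod_S3_append)
    then have "length us \<le> length (p @ q' @ r)"
      using assms unfolding reduced_decomposition_def by blast
    then show False using a by simp
  qed
  have us: "us \<in> lists {s1, s2}" using assms by (simp add: reduced_decomposition_def)
  have rep: "us \<noteq> p @ [s, s] @ r" if "s \<in> {s1, s2}" for p s r
    using shorter[of p "[s, s]" r "[]"] that by (auto simp: list_prod_S3 s1_s1 s2_s2)
  have abab: "us \<noteq> [s1, s2, s1, s2] @ r" for r
    using shorter[of "[]" "[s1, s2, s1, s2]" r "[s2, s1]"] by (simp add: list_prod_S3 s_rels)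
  have baba: "us \<noteq> [s2, s1, s2, s1] @ r" for r
    using shorter[of "[]" "[s2, s1, s2, s1]" r "[s1, s2]"] by (simp add: list_prod_S3 s_rels)
  have adj: "s \<noteq> t" if "us = p @ [s, t] @ r" for p s t r
    using rep[of s p r] us that by auto
  consider "us = []" | s where "us = [s]" | s t where "us = [s, t]"
    | s t u where "us = [s, t, u]" | s t u v r where "us = s # t # u # v # r"
    by (metis list.exhaust)
  then show ?thesis
  proof cases
    case (3 s t)
    then show ?thesis using us adj[of "[]" s t "[]"] by auto
  next
    case (4 s t u)
    then show ?thesis using us adj[of "[]" s t "[u]"] adj[of "[s]" t u "[]"] by auto
  next
    case (5 s t u v r)
    have "s \<noteq> t" "t \<noteq> u" "u \<noteq> v"
      using adj[of "[]" s t "u # v # r"] adj[of "[s]" t u "v # r"] adj[of "[s, t]" u v r] 5 by auto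
    moreover have "s \<in> {s1, s2}" "t \<in> {s1, s2}" "u \<in> {s1, s2}" "v \<in> {s1, s2}"
      using us 5 by auto
    ultimately have "us = [s1, s2, s1, s2] @ r \<or> us = [s2, s1, s2, s1] @ r"
      using 5 by auto
    then show ?thesis using abab baba by blast
  qed (use us in auto)
qed

lemma reduced_unique_S3:
  assumes "reduced_decomposition S3 {s1, s2} w us" "reduced_decomposition S3 {s1, s2} w vs"
  shows "pos_braid S3 {s1, s2} us = pos_braid S3 {s1, s2} vs"
proof -
  let ?ev = "\<lambda>us. map (list_prod S3 us) [1, 2, 3]"
  have ev: "?ev [] = [1, 2, 3]" "?ev [s1] = [2, 1, 3]" "?ev [s2] = [1, 3, 2]"
    "?ev [s1, s2] = [2, 3, 1]" "?ev [s2, s1] = [3, 1, 2]"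
    "?ev [s1, s2, s1] = [3, 2, 1]" "?ev [s2, s1, s2] = [3, 2, 1]"
    by (simp_all add: list_prod_S3 s1_def s2_def transpose_def)
  have eq: "?ev us = ?ev vs"
    using assms by (simp add: reduced_decomposition_def)
  have sep: "xs = ys \<or> {xs, ys} = {[s1, s2, s1], [s2, s1, s2]}"
    if "xs \<in> {[], [s1], [s2], [s1, s2], [s2, s1], [s1, s2, s1], [s2, s1, s2]}"
      "ys \<in> {[], [s1], [s2], [s1, s2], [s2, s1], [s1, s2, s1], [s2, s1, s2]}"
      "?ev xs = ?ev ys" for xs ys
    using that unfolding insert_iff empty_iff
    by (elim disjE FalseE; hypsubst) (simp_all only: ev, simp_all add: insert_commute)
  show ?thesis
    using sep[OF reduced_shape_S3[OF assms(1)] reduced_shape_S3[OF assms(2)] eq] pos_braid_S3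
    by (auto simp: doubleton_eq_iff)
qed

lemma braid_section_S3:
  assumes "reduced_decomposition S3 {s1, s2} w us"
  shows "braid_section S3 {s1, s2} w = pos_braid S3 {s1, s2} us"
  unfolding braid_section_def by (rule reduced_unique_S3[OF someI[of _ us]]) (rule assms)+

end

theory Submission
  imports Defs
begin

text \<open>
  Write \<open>a\<close>, \<open>b\<close> for the actions of the two generators, \<open>q = \<lambda>\<^sup>2 - 1\<close>, which is nonzero, and
  \<open>e = (a\<^sup>2 - 1) / q\<close>, \<open>f = (b\<^sup>2 - 1) / q\<close>. The cubic relation makes \<open>e\<close> and \<open>f\<close> projections onto
  the \<open>\<lambda>\<close>-eigenspaces of \<open>a\<close> and \<open>b\<close>, and these eigenspaces are the subspaces \<open>V\<^sub>s\<close>. An element of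
  \<open>K\<^sub>W(V)\<close> is a labelling of the six vertices of the Cayley graph of \<open>S\<^sub>3\<close>, a hexagon, subject to one
  condition on each edge.

  The embedded copies of \<open>V\<close> are subtracted one at a time. First \<open>i\<^sub>1(V)\<close> clears the label at \<open>1\<close>;
  then \<open>i\<^sub>a(V)\<close> and \<open>i\<^sub>b(V)\<close>, adjusted by \<open>i\<^sub>1(V)\<close>, clear the labels at \<open>a\<close> and \<open>b\<close>; and the copy for \<open>ba\<close>,
  adjusted likewise, clears the label at \<open>ba\<close>. There remain a label \<open>y\<close> at \<open>ab\<close> and a label \<open>z\<close> at \<open>aba\<close>. Both lie in \<open>eV\<close>, and
  \<open>z - b y \<in> fV\<close>. What the six copies still provide at these two places includes, up to the factor \<open>q\<close>, all
  pairs \<open>(N u + X w, X u + N w)\<close> with \<open>u, w \<in> eV\<close>, where \<open>X = ebe\<close>,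
  \<open>N = f + beb = (ba\<^sup>2b - 1) / q\<close>.

  The braid relation ties together the actions of \<open>X\<close>, \<open>Y = efe\<close> and \<open>N\<close> on \<open>eV\<close>. The
  operator \<open>ba\<^sup>2b\<close> commutes with \<open>a\<close>, so \<open>N\<close> preserves \<open>eV\<close> and equals \<open>Y + X\<^sup>2\<close> there; moreover
  \<open>Y = X\<^sup>2 - (q / \<lambda>) X Y\<close> and \<open>Y X = X + \<lambda> X\<^sup>2 - X\<^sup>3\<close>. Hence on the image of \<open>X\<close> everything is a polynomial
  in \<open>X\<close>: \<open>Y = 1 + \<lambda> X - X\<^sup>2\<close> and \<open>N = 1 + \<lambda> X\<close>. The edge condition forces \<open>y\<close> and \<open>z\<close> into this image
  and factors as \<open>(X - \<lambda>) (X z - (1 + \<lambda> X) y) = 0\<close>, and likewise with \<open>y\<close> and \<open>z\<close> exchanged.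

  For \<open>u\<close>, \<open>w\<close> in the image of \<open>X\<close> the available pair is the value at \<open>(u, w)\<close> of the symmetric matrix
  with diagonal entries \<open>1 + \<lambda> X\<close> and off-diagonal entries \<open>X\<close>, while the edge condition says that this
  matrix maps \<open>(y, -z)\<close> into the kernel of \<open>X - \<lambda>\<close>. On that kernel its determinant is the scalar
  \<open>(1 + \<lambda>\<^sup>2)\<^sup>2 - \<lambda>\<^sup>2 = \<lambda>\<^sup>4 + \<lambda>\<^sup>2 + 1\<close>, the cofactor of \<open>\<lambda>\<^sup>2 - 1\<close> in \<open>\<lambda>\<^sup>6 - 1\<close>, hence nonzero. So
  subtracting an available pair from \<open>(y, z)\<close> brings \<open>(y, -z)\<close> into the kernel of the matrix. There the
  determinant \<open>1 + 2 \<lambda> X + q X\<^sup>2\<close> vanishes, which inverts \<open>X\<close> and gives an explicit solution. All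
  this uses \<open>\<lambda> \<noteq> 0\<close>; for \<open>\<lambda> = 0\<close> invertibility of \<open>a\<close> gives \<open>eV = 0\<close>.
\<close>

section \<open>One operator with a cubic relation\<close>

text \<open>The relation is \<open>(a\<^sup>2 - 1) (a - \<lambda>) = 0\<close>. For \<open>\<lambda>\<^sup>2 \<noteq> 1\<close> it splits the space into
  \<open>ker (a - \<lambda>)\<close> and \<open>ker (a\<^sup>2 - 1)\<close>.\<close>

locale cubic_operator = vector_space scale
  for scale :: "'k::field \<Rightarrow> 'v::ab_group_add \<Rightarrow> 'v" (infixr \<open>*s\<close> 75) +
  fixes a :: "'v \<Rightarrow> 'v" and l :: 'k
  assumes linear_operator: "Vector_Spaces.linear scale scale a"
    and inj: "inj a"
    and cubic: "a (a (a v - l *s v)) = a v - l *s v"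
    and l_sq: "l\<^sup>2 \<noteq> 1"
begin

definition eigenspace :: "'v set" where "eigenspace = {v. a v = l *s v}"
definition proj :: "'v \<Rightarrow> 'v" where "proj v = (1 / (l\<^sup>2 - 1)) *s (a (a v) - v)"

lemmas lin = module_hom.add[OF module_hom_linearI, OF linear_operator]
  module_hom.diff[OF module_hom_linearI, OF linear_operator]
  module_hom.scale[OF module_hom_linearI, OF linear_operator]
  module_hom.neg[OF module_hom_linearI, OF linear_operator]
  module_hom.zero[OF module_hom_linearI, OF linear_operator]

lemma square: "a (a v) = v + (l\<^sup>2 - 1) *s proj v"
  using l_sq by (simp add: proj_def)

lemma linear_proj: "Vector_Spaces.linear scale scale proj"
  unfolding Vector_Spaces.linear_iff proj_def
  by (simp add: vector_space_axioms lin scale_right_distrib scale_right_diff_distrib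
      scale_scale mult.commute)

lemmas proj_lin = module_hom.add[OF module_hom_linearI, OF linear_proj]
  module_hom.diff[OF module_hom_linearI, OF linear_proj]
  module_hom.scale[OF module_hom_linearI, OF linear_proj]
  module_hom.neg[OF module_hom_linearI, OF linear_proj]
  module_hom.zero[OF module_hom_linearI, OF linear_proj]

lemma operator_proj: "a (proj v) = l *s proj v"
proof -
  have "a (a (a v) - v) = l *s (a (a v) - v)"
    using cubic[of v] by (simp add: lin scale_right_diff_distrib algebra_simps)
  then show ?thesis by (simp add: proj_def lin mult.commute flip: scale_scale)
     (simp add: mult.commute)
qed

lemma proj_operator: "proj (a v) = l *s proj v"
  using operator_proj[of v] by (simp add: proj_def lin)

lemma proj_eigen: "v \<in> eigenspace \<Longrightarrow> proj v = v"
proof -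
  assume "v \<in> eigenspace"
  then have "a (a v) - v = (l\<^sup>2 - 1) *s v"
    by (simp add: eigenspace_def lin scale_left_diff_distrib power2_eq_square)
  then show ?thesis using l_sq by (simp add: proj_def)
qed

lemma proj_in_eigenspace: "proj v \<in> eigenspace"
  by (simp add: eigenspace_def operator_proj)

lemma subspace_eigenspace: "subspace eigenspace"
  by (rule subspaceI) (simp_all add: eigenspace_def lin scale_right_distrib mult.commute)

lemmas eigenspace_diff = subspace_diff[OF subspace_eigenspace]

lemma range_square_minus_id: "range (\<lambda>v. a (a v) - v) = eigenspace"
proof (intro Set.set_eqI iffI)
  fix v assume "v \<in> range (\<lambda>v. a (a v) - v)"
  then show "v \<in> eigenspace"
    using proj_in_eigenspace subspace_scale[OF subspace_eigenspace] by (auto simp: square)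
next
  fix v assume "v \<in> eigenspace"
  then have "v = a (a ((1 / (l\<^sup>2 - 1)) *s v)) - (1 / (l\<^sup>2 - 1)) *s v"
    using l_sq by (simp add: square proj_lin proj_eigen)
  then show "v \<in> range (\<lambda>v. a (a v) - v)" by blast
qed

lemma id_minus_square_eigenspace: "v - a (a v) \<in> eigenspace"
proof -
  have "- (a (a v) - v) \<in> eigenspace"
    using subspace_neg[OF subspace_eigenspace] range_square_minus_id by blast
  then show ?thesis by simp
qed

lemma eigenspaceE:
  assumes "u \<in> eigenspace"
  obtains v where "u = v - a (a v)"
proof -
  obtain v where "- u = a (a v) - v"
    using subspace_neg[OF subspace_eigenspace assms]
    unfolding range_square_minus_id[symmetric] by blast
  then have "u = v - a (a v)" by (simp add: algebra_simps)
  then show thesis by (rule that)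
qed

lemma eigenspace_zero: assumes "l = 0" shows "eigenspace = {0}"
  unfolding eigenspace_def using inj assms lin(5) by (auto simp: inj_def)

end

section \<open>Two operators with a braid relation\<close>

locale cubic_braid_pair =
  A: cubic_operator scale a l + B: cubic_operator scale b l
  for scale :: "'k::field \<Rightarrow> 'v::ab_group_add \<Rightarrow> 'v" (infixr \<open>*s\<close> 75)
    and a b :: "'v \<Rightarrow> 'v" and l :: 'k +
  assumes braid: "a (b (a v)) = b (a (b v))"
begin

abbreviation "e \<equiv> A.proj"
abbreviation "f \<equiv> B.proj"
abbreviation "q \<equiv> l\<^sup>2 - 1"

lemmas lin = A.lin B.lin A.proj_lin B.proj_lin

text \<open>In the braid group \<open>b\<cdot>ab = ab\<cdot>a\<close>, so conjugation by \<open>ab\<close> carries \<open>a\<close> to \<open>b\<close>.\<close>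

lemma proj_half_twist: "f (a (b v)) = a (b (e v))"
  unfolding A.proj_def B.proj_def by (simp add: lin braid[symmetric])

lemma ba_eigenspace: "v \<in> B.eigenspace \<Longrightarrow> b (a v) \<in> A.eigenspace"
  using braid[of v] by (simp add: A.eigenspace_def B.eigenspace_def lin)
lemma ab_eigenspace: "v \<in> A.eigenspace \<Longrightarrow> a (b v) \<in> B.eigenspace"
  using braid[of v] by (simp add: A.eigenspace_def B.eigenspace_def lin)

lemma ba2b_expand: "b (a (a (b v))) = v + q *s (f v + b (e (b v)))"
  by (simp add: A.square B.square lin A.scale_right_distrib)

text \<open>The operator on both sides is \<open>N = (ba\<^sup>2b - 1) / q\<close>. In the braid group \<open>a\<cdot>ba\<^sup>2b = ba\<^sup>2b\<cdot>a\<close>, so \<open>N\<close>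
  commutes with \<open>a\<close> and therefore with \<open>e\<close>.\<close>

lemma proj_ba2b_commute: "e (f v + b (e (b v))) = f (e v) + b (e (b (e v)))"
proof -
  define N where "N v = f v + b (e (b v))" for v
  have N: "q *s N v = b (a (a (b v))) - v" for v
    by (simp add: N_def ba2b_expand)
  have c: "a (b (a (a (b v)))) = b (a (a (b (a v))))" for v
    by (simp add: braid)
  have "q *s a (N v) = q *s N (a v)" for v
    unfolding N A.lin(3)[symmetric] by (simp add: lin c)
  then have aN: "a (N v) = N (a v)" for v using A.l_sq by simp
  have Nl: "N (v - w) = N v - N w" "N (c *s v) = c *s N v" for v w c
    by (simp_all add: N_def lin A.scale_right_distrib)
  have "e (N v) = N (e v)" by (simp add: A.proj_def aN Nl)
  then show ?thesis by (simp add: N_def)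
qed

text \<open>On the \<open>\<lambda>\<close>-eigenspace of \<open>a\<close>, where \<open>e\<close> is the identity, these are the compressions of
  \<open>b\<close> and \<open>f\<close> to that eigenspace; the projection on the right is therefore left out.\<close>

definition "X v = e (b v)"
definition "Y v = e (f v)"

lemma X_lin: "X (v + w) = X v + X w" "X (v - w) = X v - X w" "X (c *s v) = c *s X v"
  "X (- v) = - X v" "X 0 = 0"
  by (simp_all add: X_def lin)


lemma X_eigen: "X v \<in> A.eigenspace" and Y_eigen: "Y v \<in> A.eigenspace"
  by (simp_all add: X_def Y_def A.proj_in_eigenspace)

lemma inverse_b: assumes "l \<noteq> 0" shows "b (b v - (q / l) *s f v) = v"
  using assms by (simp add: lin B.square B.operator_proj)

text \<open>Conjugation by \<open>ab\<close> gives \<open>f = a b e b\<^sup>-\<^sup>1a\<^sup>-\<^sup>1\<close>. Between two copies of \<open>e\<close> the outer factors \<open>a\<close> and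
  \<open>a\<^sup>-\<^sup>1\<close> become scalars, and \<open>b\<^sup>-\<^sup>1 = b - (q / \<lambda>) f\<close> turns what is left into \<open>X\<close> and \<open>Y\<close>.\<close>

lemma Y_eq_X2_minus_XY:
  assumes "l \<noteq> 0" "v \<in> A.eigenspace"
  shows "Y v = X (X v) - (q / l) *s X (Y v)"
proof -
  let ?x = "b v - (q / l) *s f v"
  have "l *s f v = a (b (e ?x))"
    using assms unfolding proj_half_twist[of ?x, symmetric] inverse_b[OF assms(1)]
    by (simp add: A.eigenspace_def lin)
  then have "e (l *s f v) = e (a (b (e ?x)))" by simp
  then have "l *s Y v = l *s X (e ?x)"
    by (simp only: A.proj_operator A.proj_lin X_def Y_def)
  also have "X (e ?x) = X (X v) - (q / l) *s X (Y v)" by (simp add: X_def Y_def lin)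
  finally show ?thesis using assms(1) by (simp only: A.scale_cancel_left) simp
qed

lemma N_on_eigenspace:
  assumes "v \<in> A.eigenspace"
  shows "f v + b (e (b v)) = Y v + X (X v)"
  using proj_ba2b_commute[of v] A.proj_eigen[OF assms] by (simp add: X_def Y_def lin)

text \<open>Commutation of \<open>N\<close> with \<open>e\<close>, tested on \<open>b v\<close>, yields \<open>(Y + X\<^sup>2) X = X + \<lambda> Y + q X Y\<close>; the
  terms in \<open>Y\<close> on the right combine to \<open>\<lambda> X\<^sup>2\<close> by the previous formula for \<open>Y\<close>.\<close>

lemma YX_eq_cubic:
  assumes "l \<noteq> 0" "v \<in> A.eigenspace"
  shows "Y (X v) = X v + l *s X (X v) - X (X (X v))"
proof -
  have "Y (X v) + X (X (X v)) = e (f (b v)) + e (b (e (b (b v))))"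
    using proj_ba2b_commute[of "b v"] N_on_eigenspace[OF X_eigen, of v] by (simp add: X_def lin)
  also have "\<dots> = l *s Y v + X v + q *s X (Y v)"
    by (simp add: B.proj_operator B.square X_def Y_def lin A.proj_eigen[OF assms(2)])
  also have "l *s Y v = l *s X (X v) - q *s X (Y v)"
    using assms by (subst Y_eq_X2_minus_XY) (simp_all add: A.scale_right_diff_distrib)
  finally show ?thesis by (simp add: algebra_simps)
qed

text \<open>On the kernel of \<open>X - \<lambda>\<close> the matrix with diagonal \<open>1 + \<lambda> X\<close> and off-diagonal \<open>X\<close> has scalar
  entries, and Cramer's rule solves the system. The span conditions keep the solution inside any
  subspace that contains the right-hand side.\<close>

lemma solve_on_kernel:
  assumes "l ^ 4 + l\<^sup>2 + 1 \<noteq> 0"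
    "X p = l *s p" "X r = l *s r"
  obtains u w where "X u = l *s u" "X w = l *s w"
    "p = u + l *s X u + X w" "r = X u + w + l *s X w"
    "u \<in> A.span {p, r}" "w \<in> A.span {p, r}"
proof -
  define D where "D = l ^ 4 + l\<^sup>2 + 1"
  define u where "u = ((1 + l\<^sup>2) / D) *s p - (l / D) *s r"
  define w where "w = ((1 + l\<^sup>2) / D) *s r - (l / D) *s p"
  have Xu: "X u = l *s u" and Xw: "X w = l *s w"
    using assms by (simp_all add: u_def w_def X_lin A.scale_right_diff_distrib mult.commute)
  have "(1 + l\<^sup>2) * (1 + l\<^sup>2) - l * l = D"
    by (simp add: D_def algebra_simps eval_nat_numeral)
  then have D: "(1 + l\<^sup>2) * ((1 + l\<^sup>2) / D) - l * (l / D) = 1"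
    using assms(1) by (simp add: D_def[symmetric] flip: diff_divide_distrib)
  have sw: "p = (1 + l\<^sup>2) *s u + l *s w"
    if "u = ((1 + l\<^sup>2) / D) *s p - (l / D) *s r" "w = ((1 + l\<^sup>2) / D) *s r - (l / D) *s p" for p r u w
  proof -
    have "(1 + l\<^sup>2) *s u + l *s w = ((1 + l\<^sup>2) * ((1 + l\<^sup>2) / D) - l * (l / D)) *s p"
      unfolding that by (simp only: A.scale_right_diff_distrib A.scale_scale A.scale_left_diff_distrib)
        (simp add: algebra_simps add_divide_distrib A.scale_left_distrib)
    then show ?thesis by (simp only: D A.scale_one)
  qed
  show thesis
  proof
    show "p = u + l *s X u + X w" "r = X u + w + l *s X w"
      using sw[OF u_def w_def] sw[OF w_def u_def]
      by (simp_all add: Xu Xw A.scale_left_distrib power2_eq_square add.commute add.left_commute)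
    show "u \<in> A.span {p, r}" "w \<in> A.span {p, r}"
      unfolding u_def w_def by (intro A.span_diff A.span_scale A.span_base; simp)+
  qed (fact Xu Xw)+
qed

text \<open>The subspace on which \<open>Y\<close> and \<open>N\<close> become polynomials in \<open>X\<close>.\<close>

definition "img = X ` A.eigenspace"

lemma subspace_img: "A.subspace img"
proof (rule A.subspaceI)
  show "0 \<in> img"
    using X_lin(5) A.subspace_0[OF A.subspace_eigenspace] unfolding img_def by (metis imageI)
  show "v + w \<in> img" if "v \<in> img" "w \<in> img" for v w
    using that A.subspace_add[OF A.subspace_eigenspace]
    unfolding img_def by (auto simp flip: X_lin)
  show "c *s v \<in> img" if "v \<in> img" for c v
    using that A.subspace_scale[OF A.subspace_eigenspace]
    unfolding img_def by (auto simp flip: X_lin)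
qed

lemma img_eigenspace: "v \<in> img \<Longrightarrow> v \<in> A.eigenspace"
  using X_eigen by (auto simp: img_def)

lemma X_img: "v \<in> A.eigenspace \<Longrightarrow> X v \<in> img"
  by (simp add: img_def)

lemmas img_intros = A.subspace_diff[OF subspace_img] A.subspace_add[OF subspace_img]
  A.subspace_scale[OF subspace_img] A.subspace_neg[OF subspace_img] X_img[OF img_eigenspace]

lemma Y_img:
  assumes "l \<noteq> 0" "v \<in> A.eigenspace"
  shows "Y v \<in> img"
  by (subst Y_eq_X2_minus_XY[OF assms])
    (intro A.subspace_diff[OF subspace_img] A.subspace_scale[OF subspace_img] X_img X_eigen Y_eigen)

lemma Y_on_img:
  assumes "l \<noteq> 0" "v \<in> img"
  shows "Y v = v + l *s X v - X (X v)"
  using assms YX_eq_cubic by (auto simp: img_def)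

lemma N_on_img:
  assumes "l \<noteq> 0" "v \<in> img"
  shows "f v + b (e (b v)) = v + l *s X v"
  using N_on_eigenspace[OF img_eigenspace[OF assms(2)]] Y_on_img[OF assms] by simp

text \<open>An edge of the hexagon carries the same condition in both directions, since \<open>b\<^sup>2\<close> is the
  identity modulo the eigenspace.\<close>

lemma edge_sym:
  assumes "z - b y \<in> B.eigenspace"
  shows "y - b z \<in> B.eigenspace"
proof -
  have "b (z - b y) + q *s f y \<in> B.eigenspace"
    using assms B.subspace_eigenspace B.proj_in_eigenspace
    by (auto simp: B.eigenspace_def lin A.scale_right_distrib mult.commute
        intro: A.subspace_add A.subspace_scale)
  then have "- (b (z - b y) + q *s f y) \<in> B.eigenspace"
    by (rule A.subspace_neg[OF B.subspace_eigenspace])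
  then show ?thesis by (simp add: lin B.square algebra_simps)
qed

lemma edge_equation:
  assumes "z \<in> A.eigenspace" "z - b y \<in> B.eigenspace"
  shows "z = Y z + X y - l *s Y y"
proof -
  have "z - b y = f z - l *s f y"
    using B.proj_eigen[OF assms(2)] by (simp add: lin B.proj_operator)
  then have "e (z - b y) = e (f z - l *s f y)" by simp
  then show ?thesis
    using A.proj_eigen[OF assms(1)] by (simp add: lin X_def Y_def algebra_simps)
qed

lemma edge_img:
  assumes "l \<noteq> 0" "y \<in> A.eigenspace" "z \<in> A.eigenspace" "z - b y \<in> B.eigenspace"
  shows "z \<in> img"
  by (subst edge_equation[OF assms(3,4)])
    (intro A.subspace_diff A.subspace_add A.subspace_scale subspace_img Y_img X_img assms)

text \<open>Substituting \<open>Y = 1 + \<lambda> X - X\<^sup>2\<close> into the edge equation \<open>(1 - Y) z = (X - \<lambda> Y) y\<close>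
  produces \<open>X (X - \<lambda>)\<close> on the left and \<open>(X - \<lambda>) (1 + \<lambda> X)\<close> on the right.\<close>

lemma edge_defect:
  assumes "l \<noteq> 0" "y \<in> img" "z \<in> img" "z - b y \<in> B.eigenspace"
  shows "X (X z - y - l *s X y) = l *s (X z - y - l *s X y)"
  using edge_equation[OF img_eigenspace[OF assms(3)] assms(4)]
  unfolding Y_on_img[OF assms(1,2)] Y_on_img[OF assms(1,3)]
  by (simp add: X_lin algebra_simps A.scale_right_distrib A.scale_left_diff_distrib
      power2_eq_square)

text \<open>The hypotheses say that the matrix kills \<open>(y, -z)\<close>. Then so does its determinant
  \<open>(1 + \<lambda> X)\<^sup>2 - X\<^sup>2 = 1 + 2 \<lambda> X + q X\<^sup>2\<close>, so that \<open>- (q X + 2 \<lambda>)\<close> inverts \<open>X\<close> on \<open>y\<close> and \<open>z\<close>, and the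
  matrix maps \<open>(v, 0)\<close> with \<open>v = X\<^sup>-\<^sup>1 z\<close> to \<open>(y, z)\<close>. The multiple \<open>2 \<lambda> z\<close> is written as a sum to
  keep scalar numerals out of the normal forms.\<close>

lemma solve_on_matrix_kernel:
  assumes yz: "y + l *s X y = X z" "z + l *s X z = X y"
    and v: "v = - (q *s X z + (l *s z + l *s z))"
  shows "X v = z" "v + l *s X v = y"
proof -
  have h: "g + l *s X g + l *s X g + q *s X (X g) = 0"
    if "g + l *s X g = X k" "k + l *s X k = X g" for g k
  proof -
    have "g + l *s X g + l *s X g + q *s X (X g) =
        g + l *s X g + l *s X (g + l *s X g) - X (X g)"
      by (simp add: X_lin algebra_simps A.scale_right_distrib A.scale_left_diff_distrib
          A.scale_left_distrib power2_eq_square)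
    also have "\<dots> = X (k + l *s X k) - X (X g)" by (simp only: that(1) X_lin)
    finally show ?thesis by (simp add: that(2))
  qed
  show "X v = z"
    using h[OF yz(2,1)] by (simp add: v X_lin add_eq_0_iff algebra_simps)
  have "v + l *s X v =
      - (q *s X (z + l *s X z) + l *s (z + l *s X z) + l *s (z + l *s X z))"
    by (simp add: v X_lin A.scale_right_distrib A.scale_right_diff_distrib
        mult.commute algebra_simps)
  also have "\<dots> = y"
    unfolding yz(2) using h[OF yz] by (simp add: add_eq_0_iff algebra_simps)
  finally show "v + l *s X v = y" .
qed

text \<open>The core of the argument: a pair left over by the reduction of the hexagon has the form that the
  embeddings produce. A first correction moves \<open>(y, -z)\<close> into the kernel of the matrix, where the problem
  has an explicit solution.\<close>

lemma edge_pair_reached: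
  assumes l: "l \<noteq> 0" and D: "l ^ 4 + l\<^sup>2 + 1 \<noteq> 0"
    and y: "y \<in> A.eigenspace" and z: "z \<in> A.eigenspace" and edge: "z - b y \<in> B.eigenspace"
  obtains u w where "u \<in> A.eigenspace" "w \<in> A.eigenspace"
    "y = f u + b (e (b u)) + e (b w)" "z = e (b u) + f w + b (e (b w))"
proof -
  have zI: "z \<in> img" by (rule edge_img[OF l y z edge])
  have yI: "y \<in> img" by (rule edge_img[OF l z y edge_sym[OF edge]])
  define p where "p = X z - y - l *s X y"
  define r where "r = X y - z - l *s X z"
  have pr: "p \<in> img" "r \<in> img" unfolding p_def r_def by (intro img_intros yI zI)+
  have span_img: "v \<in> img" if "v \<in> A.span S" "S \<subseteq> img" for v S
    using that A.span_minimal[OF _ subspace_img] by blast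
  \<comment> \<open>The matrix maps \<open>(y, -z)\<close> to \<open>(- p, r)\<close>, and it maps \<open>(s, t)\<close> to the same pair; so
    \<open>(y - s, - (z + t))\<close> lies in its kernel.\<close>
  obtain s t where st: "X s = l *s s" "X t = l *s t"
      "- p = s + l *s X s + X t" "r = X s + t + l *s X t"
      "s \<in> A.span {- p, r}" "t \<in> A.span {- p, r}"
    using solve_on_kernel[OF D, of "- p" r] edge_defect[OF l yI zI edge]
      edge_defect[OF l zI yI edge_sym[OF edge]]
    unfolding p_def[symmetric] r_def[symmetric] by (metis X_lin(4) A.scale_minus_right)
  have stI: "s \<in> img" "t \<in> img"
    using span_img[OF st(5)] span_img[OF st(6)] pr img_intros(4)[OF pr(1)] by simp_all
  \<comment> \<open>The correction \<open>(s, -t)\<close> subtracted from \<open>(y, z)\<close> is itself in the range of the matrix.\<close>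
  obtain c d where cd: "X c = l *s c" "X d = l *s d"
      "s = c + l *s X c + X d" "- t = X c + d + l *s X d"
      "c \<in> A.span {s, - t}" "d \<in> A.span {s, - t}"
    using solve_on_kernel[OF D, of s "- t"] st(1,2) by (metis X_lin(4) A.scale_minus_right)
  have cdI: "c \<in> img" "d \<in> img"
    using span_img[OF cd(5)] span_img[OF cd(6)] stI img_intros(4)[OF stI(2)] by simp_all
  define y' where "y' = y - s"
  define z' where "z' = z + t"
  have yz': "y' + l *s X y' = X z'" "z' + l *s X z' = X y'"
    using st(3,4) unfolding p_def r_def y'_def z'_def
    by (simp_all add: X_lin algebra_simps A.scale_right_distrib A.scale_right_diff_distrib)
  define v where "v = - (q *s X z' + (l *s z' + l *s z'))"
  note v = solve_on_matrix_kernel[OF yz' v_def]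
  have vI: "v \<in> img" unfolding v_def y'_def z'_def by (intro img_intros zI stI)
  show thesis
  proof (rule that[of "v + c" d])
    show "v + c \<in> A.eigenspace" "d \<in> A.eigenspace"
      by (intro img_eigenspace img_intros vI cdI)+
    have "y = (v + l *s X v) + (c + l *s X c + X d)"
      using v(2) cd(3) by (simp add: y'_def)
    also have "\<dots> = (v + c) + l *s X (v + c) + X d"
      by (simp add: X_lin A.scale_right_distrib algebra_simps)
    finally show "y = f (v + c) + b (e (b (v + c))) + e (b d)"
      using N_on_img[OF l, of "v + c"] img_intros(2)[OF vI cdI(1)] by (simp add: X_def)
    have "z = X v + (X c + d + l *s X d)"
      unfolding v(1) using cd(4) by (simp add: z'_def flip: cd(4))
    also have "\<dots> = X (v + c) + (d + l *s X d)" by (simp add: X_lin algebra_simps)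
    finally show "z = e (b (v + c)) + f d + b (e (b d))"
      using N_on_img[OF l cdI(2)] by (simp add: X_def add.assoc)
  qed
qed

section \<open>The hexagon\<close>

text \<open>The six arguments of \<open>P\<close> are the labels at \<open>1, a, b, ab, ba, aba\<close>, and \<open>P\<close> stands for
  membership in the span of the embedded copies of \<open>V\<close>. The label of \<open>i\<^sub>y(v)\<close> at \<open>w\<close> is
  \<open>\<tau>(wy\<^sup>-\<^sup>1) v\<close>, which gives the six generating families. Stating the result for a predicate keeps the
  linear algebra apart from the encoding of \<open>S\<^sub>3\<close>.\<close>

lemma hexagon_labelling:
  assumes D: "l ^ 4 + l\<^sup>2 + 1 \<noteq> 0"
    and P_diff: "\<And>x1 xa xb xab xba xw y1 ya yb yab yba yw.
      P x1 xa xb xab xba xw \<Longrightarrow> P y1 ya yb yab yba yw \<Longrightarrow>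
      P (x1 - y1) (xa - ya) (xb - yb) (xab - yab) (xba - yba) (xw - yw)"
    and P1: "\<And>v. P v (a v) (b v) (a (b v)) (b (a v)) (a (b (a v)))"
    and Pa: "\<And>v. P (a v) v (b (a v)) (a (b (a v))) (b v) (a (b v))"
    and Pb: "\<And>v. P (b v) (a (b v)) v (a v) (a (b (a v))) (b (a v))"
    and Pab: "\<And>v. P (b (a v)) (a (b (a v))) (a v) v (a (b v)) (b v)"
    and Pba: "\<And>v. P (a (b v)) (b v) (a (b (a v))) (b (a v)) v (a v)"
    and Pw: "\<And>v. P (a (b (a v))) (b (a v)) (a (b v)) (b v) (a v) v"
    and edges: "xa - a x1 \<in> A.eigenspace" "xb - b x1 \<in> B.eigenspace"
      "xab - a xb \<in> A.eigenspace" "xba - b xa \<in> B.eigenspace"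
      "xw - a xba \<in> A.eigenspace" "xw - b xab \<in> B.eigenspace"
  shows "P x1 xa xb xab xba xw"
proof -
  have P0: "P 0 0 0 0 0 0" using P_diff[OF P1[of 0] P1[of 0]] by simp
  have P_add: "P (x1 + y1) (xa + ya) (xb + yb) (xab + yab) (xba + yba) (xw + yw)"
    if "P x1 xa xb xab xba xw" "P y1 ya yb yab yba yw" for x1 xa xb xab xba xw y1 ya yb yab yba yw
    using P_diff[OF that(1) P_diff[OF P0 that(2)]] by simp
  \<comment> \<open>Differences of embedded vectors. The first two families have an arbitrary eigenvector \<open>u\<close> at
    \<open>a\<close> or \<open>b\<close> and vanish at \<open>1\<close> and at the other generator; the last two have it at \<open>ba\<close> or \<open>ab\<close>
    and vanish at \<open>1\<close>, \<open>a\<close> and \<open>b\<close>.\<close>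
  have Ja: "P 0 u 0 0 (b u) (a (b u))" if u: "u \<in> A.eigenspace" for u
  proof -
    obtain v where uv: "u = v - a (a v)" using u by (rule A.eigenspaceE)
    show ?thesis using P_diff[OF Pa[of v] P1[of "a v"]] by (simp add: lin uv)
  qed
  have Jb: "P 0 0 u (a u) 0 (b (a u))" if u: "u \<in> B.eigenspace" for u
  proof -
    obtain v where uv: "u = v - b (b v)" using u by (rule B.eigenspaceE)
    show ?thesis using P_diff[OF Pb[of v] P1[of "b v"]] by (simp add: lin uv braid)
  qed
  have Jba: "P 0 0 0 (b (a u)) u (a u)" if u: "u \<in> B.eigenspace" for u
  proof -
    obtain v where uv: "u = v - b (b v)" using u by (rule B.eigenspaceE)
    from P_diff[OF P_diff[OF Pba[of v] P1[of "a (b v)"]] Ja[OF A.id_minus_square_eigenspace[of "b v"]]]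
    show ?thesis by (simp add: lin uv) (simp add: braid)
  qed
  have Jab: "P 0 0 0 u (a (b u)) (b u)" if u: "u \<in> A.eigenspace" for u
  proof -
    obtain v where uv: "u = v - a (a v)" using u by (rule A.eigenspaceE)
    from P_diff[OF P_diff[OF Pab[of v] P1[of "b (a v)"]] Jb[OF B.id_minus_square_eigenspace[of "a v"]]]
    show ?thesis by (simp add: lin uv) (simp add: braid[symmetric])
  qed
  define G where "G y z \<longleftrightarrow> P 0 0 0 y 0 z" for y z
  have G_add: "G (y + y') (z + z')" if "G y z" "G y' z'" for y z y' z'
    using P_add that unfolding G_def by fastforce
  \<comment> \<open>Take the vectors of the two families above with labels \<open>ab u\<close> and \<open>u\<close>, so that the labels at
    \<open>ba\<close> cancel.\<close>
  have G1: "G (q *s (f u + b (e (b u)))) (q *s e (b u))" if u: "u \<in> A.eigenspace" for u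
  proof -
    have "P 0 0 0 (b (a (a (b u))) - u) 0 (a (a (b u)) - b u)"
      using P_diff[OF Jba[OF ab_eigenspace[OF u]] Jab[OF u]] by simp
    then show ?thesis unfolding G_def ba2b_expand unfolding A.square by simp
  qed
  \<comment> \<open>The copy for the longest element, reduced by the families above, contributes the same pairs
    with the two places exchanged. The reduction yields a factor \<open>q\<^sup>2\<close>, hence the rescaled \<open>v\<close>.\<close>
  have G2: "G (q *s e (b u)) (q *s (f u + b (e (b u))))" if "u \<in> A.eigenspace" for u
  proof -
    define v where "v = (1 / q) *s u"
    have u: "u = q *s v" using A.l_sq by (simp add: v_def)
    have v: "v \<in> A.eigenspace"
      unfolding v_def by (intro A.subspace_scale A.subspace_eigenspace that)
    have aav: "a (a v) = v + q *s v" by (simp add: A.square A.proj_eigen[OF v])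
    let ?y = "b v - a (b (a (b (a v)))) - 0 - a (a (b v) - b (b (a (b v)))) - b (a (a v - b (b (a v))))"
    let ?z = "v - a (b (a (a (b (a v))))) - a (b (b (a v) - a (a (b (a v))))) - b (a (a (b v) - b (b (a (b v))))) -
      a (a v - b (b (a v)))"
    have GG: "G ?y ?z"
      using P_diff[OF P_diff[OF P_diff[OF P_diff[OF Pw[of v] P1[of "a (b (a v))"]]
        Ja[OF A.id_minus_square_eigenspace[of "b (a v)"]]]
        Jb[OF B.id_minus_square_eigenspace[of "a (b v)"]]]
        Jba[OF B.id_minus_square_eigenspace[of "a v"]]]
      unfolding G_def by (simp add: lin) (simp add: braid)
    \<comment> \<open>The braid group identities \<open>ababa = ab\<^sup>2ab\<close>, \<open>bab\<^sup>2a = a\<^sup>2ba\<^sup>2\<close> and \<open>bab\<^sup>2ab = a\<^sup>2ba\<^sup>2b\<close>, the last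
      word being the full twist.\<close>
    have c: "a (b (a (b (a v)))) = a (b (b (a (b v))))" "b (a (b (b (a v)))) = a (a (b (a (a v))))"
      "b (a (b (b (a (b v))))) = a (a (b (a (a (b v)))))"
      by (metis braid)+
    have "?y = (b v - b (a (a v))) - a (a (b v - b (a (a v))))"
      by (simp add: lin c)
    also have "\<dots> = q *s e (b u)"
      unfolding u A.square[of "b v - b (a (a v))"] by (simp add: lin aav)
    finally have y: "?y = q *s e (b u)" .
    let ?n = "f v + b (e (b v))"
    have "?z = a (a (b (a (a (b v))) - v)) - (b (a (a (b v))) - v)"
      by (simp add: lin c)
    also have "\<dots> = q *s (f u + b (e (b u)))"
    proof -
      have "?n \<in> A.eigenspace"
        unfolding N_on_eigenspace[OF v] by (intro A.subspace_add A.subspace_eigenspace X_eigen Y_eigen)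
      then have "a (a (q *s ?n)) - q *s ?n = q *s (q *s ?n)"
        unfolding A.square A.proj_lin(3) by (simp only: A.proj_eigen add_diff_cancel_left')
      moreover have "b (a (a (b v))) - v = q *s ?n" by (simp add: ba2b_expand)
      moreover have "f u + b (e (b u)) = q *s ?n" by (simp add: u lin A.scale_right_distrib)
      ultimately show ?thesis by simp
    qed
    finally show ?thesis using GG y by simp
  qed
  have G: "G y z" if yz: "y \<in> A.eigenspace" "z \<in> A.eigenspace" "z - b y \<in> B.eigenspace" for y z
  proof (cases "l = 0")
    case True
    then show ?thesis using yz A.eigenspace_zero P0 by (simp add: G_def)
  next
    case False
    obtain u w where uw: "u \<in> A.eigenspace" "w \<in> A.eigenspace"
      "y = f u + b (e (b u)) + e (b w)" "z = e (b u) + f w + b (e (b w))"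
      using edge_pair_reached[OF False D yz] .
    define u' w' where "u' = (1 / q) *s u" and "w' = (1 / q) *s w"
    have uw': "u' \<in> A.eigenspace" "w' \<in> A.eigenspace"
      unfolding u'_def w'_def by (intro A.subspace_scale A.subspace_eigenspace uw)+
    have "u = q *s u'" "w = q *s w'" using A.l_sq by (simp_all add: u'_def w'_def)
    then show ?thesis using G_add[OF G1[OF uw'(1)] G2[OF uw'(2)]]
      by (simp add: uw(3,4) lin A.scale_right_distrib add.assoc)
  qed
  define ca where "ca = xa - a x1"
  define cb where "cb = xb - b x1"
  define cba where "cba = xba - b xa"
  define cab where "cab = xab - a xb"
  have c: "ca \<in> A.eigenspace" "cb \<in> B.eigenspace" "cba \<in> B.eigenspace" "cab \<in> A.eigenspace"
    using edges by (simp_all add: ca_def cb_def cba_def cab_def)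
  \<comment> \<open>The labels at \<open>ab\<close> and \<open>aba\<close> left over when the other four have been cleared.\<close>
  define y where "y = cab - b (a cba)"
  define z where "z = (xw - a xba) - b (a cb)"
  have "z - b y = (xw - b xab) - (a cba - b (b (a cba))) - a (b ca)"
    by (simp add: y_def z_def ca_def cb_def cba_def cab_def lin braid)
  also have "\<dots> \<in> B.eigenspace"
    by (intro B.eigenspace_diff edges(6) B.id_minus_square_eigenspace ab_eigenspace c)
  finally have "z - b y \<in> B.eigenspace" .
  moreover have "y \<in> A.eigenspace" "z \<in> A.eigenspace"
    unfolding y_def z_def
    by (intro A.eigenspace_diff edges(5) ba_eigenspace c)+
  ultimately have "P 0 0 0 y 0 z" using G unfolding G_def by simp
  from P_add[OF P_add[OF P_add[OF P_add[OF P1[of x1] Ja[OF c(1)]] Jb[OF c(2)]] Jba[OF c(3)]] this]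
  show ?thesis
    by (simp add: y_def z_def ca_def cb_def cba_def cab_def lin braid)
qed

end

section \<open>Words and the canonical section for the symmetric group on three letters\<close>

text \<open>Together with associativity this is a complete rewriting system, whose normal forms are the six
  elements in the next lemma.\<close>

lemma S3_rewrites:
  "s1 \<circ> s1 = id" "s1 \<circ> (s1 \<circ> w) = w" "s2 \<circ> s2 = id" "s2 \<circ> (s2 \<circ> w) = w"
  "s2 \<circ> (s1 \<circ> s2) = s1 \<circ> (s2 \<circ> s1)" "s2 \<circ> (s1 \<circ> (s2 \<circ> w)) = s1 \<circ> (s2 \<circ> (s1 \<circ> w))"
  "s1 \<circ> (s2 \<circ> (s1 \<circ> s2)) = s2 \<circ> s1"
  using s1_s1 s2_s2 s_braid s_rels(1) by (metis comp_assoc comp_id id_comp)+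

lemma carrier_S3:
  "carrier S3 = {id, s1, s2, s1 \<circ> s2, s2 \<circ> s1, s1 \<circ> (s2 \<circ> s1)}" (is "_ = ?C")
proof -
  let ?ev = "\<lambda>w :: nat \<Rightarrow> nat. (w 1, w 2, w 3)"
  have "?ev ` ?C = {(1, 2, 3), (2, 1, 3), (1, 3, 2), (2, 3, 1), (3, 1, 2), (3, 2, 1)}"
    by (simp add: s1_def s2_def transpose_def)
  moreover have "card \<dots> = 6" by simp
  ultimately have "6 \<le> card ?C" using card_image_le[of ?C ?ev] by simp
  moreover have "?C \<subseteq> carrier S3"
    using s1_carrier s2_carrier by (auto simp: sym_group_carrier permutes_id intro!: permutes_compose)
  moreover have "card (carrier S3) = 6" "finite (carrier S3)"
    by (simp_all add: sym_group_card_carrier fact_numeral card_ge_0_finite)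
  ultimately show ?thesis using card_seteq[of "carrier S3" ?C] by simp
qed

text \<open>A shortest word with the same product exists and has one of the seven possible shapes. Images of
  the letters tell the shapes apart, except for the two words of length three, so a shortest word has
  the same length as the given one.\<close>

lemma reduced_S3:
  assumes "us \<in> {[], [s1], [s2], [s1, s2], [s2, s1], [s1, s2, s1]}"
  shows "reduced_decomposition S3 {s1, s2} (list_prod S3 us) us"
proof -
  define P where "P vs \<longleftrightarrow> vs \<in> lists {s1, s2} \<and> list_prod S3 vs = list_prod S3 us" for vs
  have us: "P us" using assms by (auto simp: P_def)
  obtain vs where vs: "P vs" "\<And>ws. P ws \<Longrightarrow> length vs \<le> length ws"
    using ex_has_least_nat[of P us length] us by auto
  then have red: "reduced_decomposition S3 {s1, s2} (list_prod S3 us) vs"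
    by (auto simp: reduced_decomposition_def P_def)
  let ?ev = "\<lambda>us. map (list_prod S3 us) [1, 2, 3]"
  have ev: "?ev [] = [1, 2, 3]" "?ev [s1] = [2, 1, 3]" "?ev [s2] = [1, 3, 2]"
    "?ev [s1, s2] = [2, 3, 1]" "?ev [s2, s1] = [3, 1, 2]"
    "?ev [s1, s2, s1] = [3, 2, 1]" "?ev [s2, s1, s2] = [3, 2, 1]"
    by (simp_all add: list_prod_S3 s1_def s2_def transpose_def)
  have "?ev vs = ?ev us" using vs(1) by (simp add: P_def)
  then have "length us = length vs"
    using assms reduced_shape_S3[OF red] unfolding insert_iff empty_iff
    by (elim disjE FalseE; hypsubst) (simp_all only: ev, simp_all)
  then show ?thesis
    using vs us by (auto simp: reduced_decomposition_def P_def)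
qed

context
  fixes scale :: "'k::field \<Rightarrow> 'v::ab_group_add \<Rightarrow> 'v"
    and \<rho> :: "(nat \<Rightarrow> nat) word set \<Rightarrow> 'v \<Rightarrow> 'v"
  assumes rep: "representation Br3 scale \<rho>"
begin

interpretation group_action Br3 UNIV \<rho>
  using rep by (simp add: representation_def)

lemma pos_braid_carrier: "us \<in> lists {s1, s2} \<Longrightarrow> pos_braid S3 {s1, s2} us \<in> carrier Br3"
  unfolding braid_group_S3[symmetric]
  by (auto simp: braid_group_def presented_group_def pos_braid_def pos_word_def words_def intro!: quotientI)

lemma action_pos_braid:
  "us \<in> lists {s1, s2} \<Longrightarrow>
    \<rho> (pos_braid S3 {s1, s2} us) v = foldr (\<lambda>s. \<rho> (braid_gen S3 {s1, s2} s)) us v"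
proof (induction us)
  case Nil
  have "\<one>\<^bsub>Br3\<^esub> = pos_braid S3 {s1, s2} []"
    by (simp add: pos_braid_def pos_word_def presented_group_def braid_group_def flip: braid_group_S3)
  then show ?case using fun_cong[OF id_eq_one, of v] by simp
next
  case (Cons s us)
  have "pos_braid S3 {s1, s2} (s # us) = braid_gen S3 {s1, s2} s \<otimes>\<^bsub>Br3\<^esub> pos_braid S3 {s1, s2} us"
    using Cons.prems unfolding pos_braid_def braid_gen_def braid_group_S3[symmetric] braid_group_def
    by (subst presented_group_mult) (auto simp: pos_word_def words_def)
  moreover have "braid_gen S3 {s1, s2} s \<in> carrier Br3" "pos_braid S3 {s1, s2} us \<in> carrier Br3"
    using Cons.prems by (auto simp: braid_gen_def intro: pos_braid_carrier)
  ultimately show ?case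
    using Cons composition_rule[of v "braid_gen S3 {s1, s2} s" "pos_braid S3 {s1, s2} us"] by simp
qed

lemma action_section:
  assumes "us \<in> {[], [s1], [s2], [s1, s2], [s2, s1], [s1, s2, s1]}"
  shows "\<rho> (braid_section S3 {s1, s2} (foldr (\<circ>) us id)) v =
    foldr (\<lambda>s. \<rho> (braid_gen S3 {s1, s2} s)) us v"
  using braid_section_S3[OF reduced_S3[OF assms]] action_pos_braid[of us v] assms
  by (auto simp: list_prod_S3)

lemma action_braid:
  "\<rho> (braid_gen S3 {s1, s2} s1) (\<rho> (braid_gen S3 {s1, s2} s2) (\<rho> (braid_gen S3 {s1, s2} s1) v)) =
   \<rho> (braid_gen S3 {s1, s2} s2) (\<rho> (braid_gen S3 {s1, s2} s1) (\<rho> (braid_gen S3 {s1, s2} s2) v))"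
  using pos_braid_S3 action_pos_braid[of "[s1, s2, s1]" v] action_pos_braid[of "[s2, s1, s2]" v] by simp

lemma action_inj: "s \<in> {s1, s2} \<Longrightarrow> inj (\<rho> (braid_gen S3 {s1, s2} s))"
  unfolding braid_gen_def by (rule inj_prop, rule pos_braid_carrier) auto

lemma action_linear: "s \<in> {s1, s2} \<Longrightarrow> Vector_Spaces.linear scale scale (\<rho> (braid_gen S3 {s1, s2} s))"
  using rep pos_braid_carrier[of "[s]"] by (auto simp: braid_gen_def representation_def)

end

section \<open>Goodness\<close>

text \<open>The Coxeter-theoretic side: the spaces \<open>V\<^sub>s\<close> are the eigenspaces, the embedded copies satisfy the
  edge conditions, and evaluation at the six elements of \<open>S\<^sub>3\<close> turns the converse inclusion into the
  statement about the hexagon.\<close>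

lemma good_S3_if_cubic_braid_pair:
  fixes scale :: "'k::field \<Rightarrow> 'v::ab_group_add \<Rightarrow> 'v"
    and \<rho> :: "(nat \<Rightarrow> nat) word set \<Rightarrow> 'v \<Rightarrow> 'v"
  assumes rep: "representation Br3 scale \<rho>"
    and pair: "cubic_braid_pair scale (\<rho> (braid_gen S3 {s1, s2} s1)) (\<rho> (braid_gen S3 {s1, s2} s2)) l"
    and D: "l ^ 4 + l\<^sup>2 + 1 \<noteq> 0"
  shows "good S3 {s1, s2} scale \<rho>"
proof -
  define a where "a = \<rho> (braid_gen S3 {s1, s2} s1)"
  define b where "b = \<rho> (braid_gen S3 {s1, s2} s2)"
  interpret cubic_braid_pair scale a b l using pair by (simp add: a_def b_def)
  interpret S3: group S3 by (rule sym_group_is_group)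
  interpret fun_space: vector_space "\<lambda>c (x :: (nat \<Rightarrow> nat) \<Rightarrow> 'v) w. scale c (x w)"
    by unfold_locales (auto simp: fun_eq_iff A.scale_right_distrib A.scale_left_distrib)
  let ?T = "\<lambda>w. \<rho> (braid_section S3 {s1, s2} w)"
  note T = action_section[OF rep]
  have T: "?T id = (\<lambda>v. v)" "?T s1 = a" "?T s2 = b" "?T (s1 \<circ> s2) = (\<lambda>v. a (b v))"
    "?T (s2 \<circ> s1) = (\<lambda>v. b (a v))" "?T (s1 \<circ> (s2 \<circ> s1)) = (\<lambda>v. a (b (a v)))"
    using T[of "[]"] T[of "[s1]"] T[of "[s2]"] T[of "[s1, s2]"] T[of "[s2, s1]"] T[of "[s1, s2, s1]"]
    by (simp_all add: a_def b_def fun_eq_iff)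
  have V_sub: "V_sub S3 {s1, s2} \<rho> s1 = A.eigenspace" "V_sub S3 {s1, s2} \<rho> s2 = B.eigenspace"
    unfolding V_sub_def A.range_square_minus_id[symmetric] B.range_square_minus_id[symmetric]
    by (simp_all add: a_def b_def fun_diff_def)
  have V_sub_subspace: "A.subspace (V_sub S3 {s1, s2} \<rho> s)" if "s \<in> {s1, s2}" for s
    using that V_sub A.subspace_eigenspace B.subspace_eigenspace by auto
  have inv_S3: "inv\<^bsub>S3\<^esub> id = id" "inv\<^bsub>S3\<^esub> s1 = s1" "inv\<^bsub>S3\<^esub> s2 = s2" "inv\<^bsub>S3\<^esub> (s1 \<circ> s2) = s2 \<circ> s1"
    "inv\<^bsub>S3\<^esub> (s2 \<circ> s1) = s1 \<circ> s2" "inv\<^bsub>S3\<^esub> (s1 \<circ> (s2 \<circ> s1)) = s1 \<circ> (s2 \<circ> s1)"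
    by (rule S3.inv_equality; simp add: carrier_S3 sym_group_mult sym_group_one comp_assoc S3_rewrites)+
  \<comment> \<open>If \<open>s\<close> lengthens \<open>w\<close>, the difference is zero. Otherwise \<open>\<tau>(w) = s \<tau>(sw)\<close>, and the difference is
    of the form \<open>v - s\<^sup>2 v\<close>.\<close>
  have edge: "?T (s \<circ> w) v - \<rho> (braid_gen S3 {s1, s2} s) (?T w v) \<in> V_sub S3 {s1, s2} \<rho> s"
    if "s \<in> {s1, s2}" "w \<in> carrier S3" for s w v
  proof -
    have "0 \<in> A.eigenspace" "0 \<in> B.eigenspace"
      "v - a (a v) \<in> A.eigenspace" "v - b (b v) \<in> B.eigenspace" for v
      using A.subspace_0[OF A.subspace_eigenspace] A.subspace_0[OF B.subspace_eigenspace]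
        A.id_minus_square_eigenspace B.id_minus_square_eigenspace by auto
    moreover have "b (a v) - b (a (b (b v))) \<in> A.eigenspace"
      using A.id_minus_square_eigenspace[of "b (a v)"] by (simp add: braid)
    ultimately show ?thesis
      using that unfolding carrier_S3
      by (auto simp: V_sub T S3_rewrites comp_assoc braid a_def[symmetric] b_def[symmetric])
  qed
  let ?U = "\<Union>y\<in>carrier S3. range (K_embed S3 {s1, s2} \<rho> y)"
  have K: "fun_space.subspace (K_space S3 {s1, s2} \<rho>)"
  proof (rule fun_space.subspaceI)
    have \<rho>_lin: "\<rho> (braid_gen S3 {s1, s2} s) 0 = 0"
        "\<rho> (braid_gen S3 {s1, s2} s) (v + w) = \<rho> (braid_gen S3 {s1, s2} s) v + \<rho> (braid_gen S3 {s1, s2} s) w"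
        "\<rho> (braid_gen S3 {s1, s2} s) (scale c v) = scale c (\<rho> (braid_gen S3 {s1, s2} s) v)"
      if "s \<in> {s1, s2}" for s v w c
      using that lin unfolding a_def b_def by auto
    show "0 \<in> K_space S3 {s1, s2} \<rho>"
      using A.subspace_0[OF V_sub_subspace] \<rho>_lin(1) by (auto simp: K_space_def)
    show "x + y \<in> K_space S3 {s1, s2} \<rho>"
      if "x \<in> K_space S3 {s1, s2} \<rho>" "y \<in> K_space S3 {s1, s2} \<rho>" for x y
      unfolding K_space_def
    proof (intro CollectI conjI ballI allI impI)
      fix s w assume s: "s \<in> {s1, s2}" and w: "w \<in> carrier S3"
      let ?d = "\<lambda>x. x (s \<otimes>\<^bsub>S3\<^esub> w) - \<rho> (braid_gen S3 {s1, s2} s) (x w)"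
      have "?d x \<in> V_sub S3 {s1, s2} \<rho> s" "?d y \<in> V_sub S3 {s1, s2} \<rho> s"
        using that s w unfolding K_space_def by blast+
      then have "?d x + ?d y \<in> V_sub S3 {s1, s2} \<rho> s"
        by (rule A.subspace_add[OF V_sub_subspace[OF s]])
      then show "?d (x + y) \<in> V_sub S3 {s1, s2} \<rho> s"
        using \<rho>_lin(2)[OF s] by (simp add: algebra_simps)
    qed (use that in \<open>auto simp: K_space_def\<close>)
    show "(\<lambda>w. scale c (x w)) \<in> K_space S3 {s1, s2} \<rho>" if "x \<in> K_space S3 {s1, s2} \<rho>" for c x
      unfolding K_space_def
    proof (intro CollectI conjI ballI allI impI)
      fix s w assume s: "s \<in> {s1, s2}" and w: "w \<in> carrier S3"
      let ?d = "\<lambda>x. x (s \<otimes>\<^bsub>S3\<^esub> w) - \<rho> (braid_gen S3 {s1, s2} s) (x w)"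
      have "?d x \<in> V_sub S3 {s1, s2} \<rho> s"
        using that s w unfolding K_space_def by blast
      then have "scale c (?d x) \<in> V_sub S3 {s1, s2} \<rho> s"
        by (rule A.subspace_scale[OF V_sub_subspace[OF s]])
      then show "?d (\<lambda>w. scale c (x w)) \<in> V_sub S3 {s1, s2} \<rho> s"
        using \<rho>_lin(3)[OF s] by (simp add: A.scale_right_diff_distrib)
    qed (use that in \<open>auto simp: K_space_def\<close>)
  qed
  have sub: "fun_space.span ?U \<subseteq> K_space S3 {s1, s2} \<rho>"
  proof (rule fun_space.span_minimal[OF _ K])
    have "K_embed S3 {s1, s2} \<rho> y v \<in> K_space S3 {s1, s2} \<rho>" if y: "y \<in> carrier S3" for y v
      unfolding K_space_def
    proof (intro CollectI conjI ballI allI impI)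
      fix s w assume s: "s \<in> {s1, s2}" and w: "w \<in> carrier S3"
      have "s \<in> carrier S3" using s s1_carrier s2_carrier by auto
      then show "K_embed S3 {s1, s2} \<rho> y v (s \<otimes>\<^bsub>S3\<^esub> w) -
          \<rho> (braid_gen S3 {s1, s2} s) (K_embed S3 {s1, s2} \<rho> y v w) \<in> V_sub S3 {s1, s2} \<rho> s"
        using edge[OF s S3.m_closed[OF w S3.inv_closed[OF y]], of v] w S3.m_closed
        by (simp add: K_embed_def sym_group_mult comp_assoc)
    qed (simp add: K_embed_def)
    then show "?U \<subseteq> K_space S3 {s1, s2} \<rho>" by auto
  qed
  have "x \<in> fun_space.span ?U" if x: "x \<in> K_space S3 {s1, s2} \<rho>" for x
  proof -
    define P where "P x1 xa xb xab xba xw \<longleftrightarrow> (\<exists>g\<in>fun_space.span ?U. g id = x1 \<and> g s1 = xa \<and> g s2 = xb \<and>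
      g (s1 \<circ> s2) = xab \<and> g (s2 \<circ> s1) = xba \<and> g (s1 \<circ> (s2 \<circ> s1)) = xw)" for x1 xa xb xab xba xw
    have P_diff: "P (x1 - y1) (xa - ya) (xb - yb) (xab - yab) (xba - yba) (xw - yw)"
      if PP: "P x1 xa xb xab xba xw" "P y1 ya yb yab yba yw"
      for x1 xa xb xab xba xw y1 ya yb yab yba yw
    proof -
      obtain g h where "g \<in> fun_space.span ?U" "h \<in> fun_space.span ?U"
        "g id = x1 \<and> g s1 = xa \<and> g s2 = xb \<and>
          g (s1 \<circ> s2) = xab \<and> g (s2 \<circ> s1) = xba \<and> g (s1 \<circ> (s2 \<circ> s1)) = xw"
        "h id = y1 \<and> h s1 = ya \<and> h s2 = yb \<and>
          h (s1 \<circ> s2) = yab \<and> h (s2 \<circ> s1) = yba \<and> h (s1 \<circ> (s2 \<circ> s1)) = yw"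
        using PP unfolding P_def by blast
      then show ?thesis
        unfolding P_def by (intro bexI[of _ "g - h"] fun_space.span_diff) (simp_all add: fun_diff_def)
    qed
    have P_embed: "P (K y v id) (K y v s1) (K y v s2) (K y v (s1 \<circ> s2)) (K y v (s2 \<circ> s1)) (K y v (s1 \<circ> (s2 \<circ> s1)))"
      if "K = K_embed S3 {s1, s2} \<rho>" "y \<in> carrier S3" for K y v
      unfolding P_def using that by (intro bexI[of _ "K y v"] fun_space.span_base) auto
    note P_embed = P_embed[OF HOL.refl, unfolded K_embed_def carrier_S3]
    have edges: "x (s1 \<circ> w) - a (x w) \<in> A.eigenspace" "x (s2 \<circ> w) - b (x w) \<in> B.eigenspace"
      if "w \<in> carrier S3" for w
      using x that unfolding K_space_def by (auto simp: sym_group_mult V_sub a_def b_def)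
    have "P (x id) (x s1) (x s2) (x (s1 \<circ> s2)) (x (s2 \<circ> s1)) (x (s1 \<circ> (s2 \<circ> s1)))"
    proof (rule hexagon_labelling[where P = P, OF D P_diff])
      show "P v (a v) (b v) (a (b v)) (b (a v)) (a (b (a v)))" for v
        using P_embed[of id v] by (simp add: sym_group_mult inv_S3 comp_assoc S3_rewrites T braid)
      show "P (a v) v (b (a v)) (a (b (a v))) (b v) (a (b v))" for v
        using P_embed[of s1 v] by (simp add: sym_group_mult inv_S3 comp_assoc S3_rewrites T braid)
      show "P (b v) (a (b v)) v (a v) (a (b (a v))) (b (a v))" for v
        using P_embed[of s2 v] by (simp add: sym_group_mult inv_S3 comp_assoc S3_rewrites T braid)
      show "P (b (a v)) (a (b (a v))) (a v) v (a (b v)) (b v)" for v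
        using P_embed[of "s1 \<circ> s2" v] by (simp add: sym_group_mult inv_S3 comp_assoc S3_rewrites T braid)
      show "P (a (b v)) (b v) (a (b (a v))) (b (a v)) v (a v)" for v
        using P_embed[of "s2 \<circ> s1" v] by (simp add: sym_group_mult inv_S3 comp_assoc S3_rewrites T braid)
      show "P (a (b (a v))) (b (a v)) (a (b v)) (b v) (a v) v" for v
        using P_embed[of "s1 \<circ> (s2 \<circ> s1)" v] by (simp add: sym_group_mult inv_S3 comp_assoc S3_rewrites T braid)
    qed (use edges[of id] edges[of s1] edges[of s2] edges[of "s1 \<circ> s2"] edges[of "s2 \<circ> s1"] in
        \<open>simp_all add: carrier_S3 S3_rewrites\<close>)
    then obtain g where g: "g \<in> fun_space.span ?U" "g id = x id \<and> g s1 = x s1 \<and> g s2 = x s2 \<and>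
      g (s1 \<circ> s2) = x (s1 \<circ> s2) \<and> g (s2 \<circ> s1) = x (s2 \<circ> s1) \<and> g (s1 \<circ> (s2 \<circ> s1)) = x (s1 \<circ> (s2 \<circ> s1))"
      unfolding P_def by blast
    have "g w = x w" for w
    proof (cases "w \<in> carrier S3")
      case True
      then show ?thesis using g(2) unfolding carrier_S3 by auto
    next
      case False
      then show ?thesis using x sub g(1) unfolding K_space_def by auto
    qed
    then have "g = x" by auto
    then show ?thesis using g(1) by simp
  qed
  then show ?thesis using sub unfolding good_def by blast
qed

theorem theorem11p2p5:
  fixes scale :: "'k::field \<Rightarrow> 'v::ab_group_add \<Rightarrow> 'v"
    and \<rho> :: "(nat \<Rightarrow> nat) word set \<Rightarrow> 'v \<Rightarrow> 'v"
    and lam :: 'k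
  assumes "representation Br3 scale \<rho>"
    and "\<And>s. s \<in> {s1, s2} \<Longrightarrow>
      ((\<rho> (braid_gen S3 {s1, s2} s) \<circ> \<rho> (braid_gen S3 {s1, s2} s)) - id) \<circ>
      (\<rho> (braid_gen S3 {s1, s2} s) - scale lam) = 0"
    and "lam ^ 6 \<noteq> 1"
  shows "good S3 {s1, s2} scale \<rho>"
proof -
  have "(lam\<^sup>2 - 1) * (lam ^ 4 + lam\<^sup>2 + 1) = lam ^ 6 - 1"
    by (simp add: algebra_simps flip: power_add)
  then have lam: "lam\<^sup>2 \<noteq> 1" "lam ^ 4 + lam\<^sup>2 + 1 \<noteq> 0" using assms(3) by auto
  have "cubic_operator scale (\<rho> (braid_gen S3 {s1, s2} s)) lam" if s: "s \<in> {s1, s2}" for s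
  proof (rule cubic_operator.intro)
    show "vector_space scale" using assms(1) by (simp add: representation_def)
    show "cubic_operator_axioms scale (\<rho> (braid_gen S3 {s1, s2} s)) lam"
    proof (rule cubic_operator_axioms.intro)
      fix v
      show "\<rho> (braid_gen S3 {s1, s2} s) (\<rho> (braid_gen S3 {s1, s2} s) (\<rho> (braid_gen S3 {s1, s2} s) v - scale lam v)) =
        \<rho> (braid_gen S3 {s1, s2} s) v - scale lam v"
        using fun_cong[OF assms(2)[OF s], of v] by (simp add: fun_diff_def zero_fun_def)
    qed (use action_linear[OF assms(1) s] action_inj[OF assms(1) s] lam in simp_all)
  qed
  then have "cubic_braid_pair scale (\<rho> (braid_gen S3 {s1, s2} s1)) (\<rho> (braid_gen S3 {s1, s2} s2)) lam"
    using action_braid[OF assms(1)] by (simp add: cubic_braid_pair_def cubic_braid_pair_axioms_def)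
  from good_S3_if_cubic_braid_pair[OF assms(1) this lam(2)] show ?thesis .
qed

end
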